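(* Let $E_2,Y_1,Z,\mu_{\rm in},d_0$ be produced by the cellular joint construction described in the context. Let $0<c\le1$, let $E^\star\subset E_2$, and define $Z^\star(B)=\bigcup_{Q:(B,Q)\in E^\star}Q$. Suppose $$\sum_B|Z^\star(B)|\ge c\sum_B|Z(B)|.$$ For $T\in\mathcal T_B$ set $Y^\star(T)=Y_1(T)\cap\bigcup_{Q:(B,Q)\in E^\star}Q$. Then $$M(Y^\star)\ge\frac c2M(Y_1).$$ Furthermore the common inner multiplicity, exact cellular compatibility and the original pointwise product upper bound survive: for every $B$, $\mu_{\rm in}\le\sum_{T\in\mathcal T_B}\mathbf 1_{Y^\star(T)}<2\mu_{\rm in}$ on $U(\mathcal T_B,Y^\star)$; $Z^\star(B)=\mathcal C_h(U(\mathcal T_B,Y^\star))$; and $\sum_{T\in\mathcal T}\mathbf 1_{Y^\star(T)}(x)<4\mu_{\rm in}d_0$ for every $x\in U(\mathcal T,Y^\star)$.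
   Context: Families are finite and labelled (coincident carriers with different labels are distinct; sums count labels). $|\cdot|$ is Lebesgue measure in $\mathbb R^3$; $U(\mathcal F,Y)=\bigcup_{F\in\mathcal F}Y(F)$; $M(Y)=\sum_B\sum_{T\in\mathcal T_B}|Y(T)|$. Setting. Let $0<a\le b\le r$, $0<c_0\le10^{-3}$, $h=c_0a$, $\mathcal Q_h=\{h(k+[0,1)^3):k\in\mathbb Z^3\}$; $\mathcal C_h(E)$ is the union of all cells $Q\in\mathcal Q_h$ with $Q\cap E\ne\varnothing$. $\mathcal B$ is a finite nonempty labelled family of parents, each carrying an arbitrarily oriented $a\times b\times r$ rectangular box $B^\sharp$. $\mathcal T=\bigsqcup_{B\in\mathcal B}\mathcal T_B$ is a finite indexed family; every $T\in\mathcal T_B$ is contained in $B^\sharp$ and has a measurable shading $Y(T)\subset T$; assume $0<M(Y)<\infty$. Let $N_{\max}=\max_B|\mathcal T_B|$. Construction. (1) With $f_B(x)=\sum_{T\in\mathcal T_B}\mathbf 1_{Y(T)}(x)$ and $X_{B,k}=\{2^k\le f_B<2^{k+1}\}$, choose $k_0\in\{0,\dots,\lceil\log_2N_{\max}\rceil\}$ with $\sum_B\int_{X_{B,k_0}}f_B\ge(1+\lceil\log_2N_{\max}\rceil)^{-1}M(Y)$. Put $\mu_{\rm in}=2^{k_0}$, $Y_0(T)=Y(T)\cap X_{B,k_0}$ for $T\in\mathcal T_B$. (2) Put $\omega_{BQ}=\sum_{T\in\mathcal T_B}|Y_0(T)\cap Q|$ for $Q\in\mathcal Q_h$ and $E^+=\{(B,Q):\omega_{BQ}>0\}$.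 Choose $E_1\subset E^+$ and $\omega_0>0$ with $\omega_0\le\omega_e<2\omega_0$ on $E_1$ and $\sum_{E_1}\omega_e\ge\frac{1}{2(1+\lceil\log_2(2|E^+|)\rceil)}\sum_{E^+}\omega_e$. (3) With $d_1(Q)=\#\{B:(B,Q)\in E_1\}$, choose a dyadic number $d_0$ for which the cells with $d_0\le d_1(Q)<2d_0$ carry the greatest $E_1$-weight, and put $E_2=\{(B,Q)\in E_1:d_0\le d_1(Q)<2d_0\}$. (4) Put $Z(B)=\bigcup_{Q:(B,Q)\in E_2}Q$ and $Y_1(T)=Y_0(T)\cap Z(B)$ for $T\in\mathcal T_B$. *)

theory Defs
  imports "HOL-Analysis.Analysis"
begin

text \<open>
  A labelled family is a finite set of labels. The objects attached to the labels (boxes, carriers,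
  shadings) are functions on labels, so objects with different labels may coincide as sets.
  The disjoint union of the families \<open>T_B\<close> is a set \<open>Ts\<close> of labels together with a map
  \<open>par\<close> that sends each label to its parent. Measures take values in \<^typ>\<open>ennreal\<close>.
\<close>

type_synonym pt = "real ^ 3"

definition rect_box :: "real \<Rightarrow> real \<Rightarrow> real \<Rightarrow> pt set \<Rightarrow> bool" where
  "rect_box a b r S \<longleftrightarrow>
     (\<exists>(p::pt) (f::pt \<Rightarrow> pt). orthogonal_transformation f \<and> S = (\<lambda>x. p + f x) ` cbox 0 (vector [a, b, r]))"

definition cell :: "real \<Rightarrow> int ^ 3 \<Rightarrow> pt set" where
  "cell h k = {x. \<forall>i. h * of_int (k $ i) \<le> x $ i \<and> x $ i < h * (of_int (k $ i) + 1)}"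

definition cells :: "real \<Rightarrow> pt set set" where
  "cells h = range (cell h)"

definition cell_hull :: "real \<Rightarrow> pt set \<Rightarrow> pt set" where
  "cell_hull h E = \<Union>{Q \<in> cells h. Q \<inter> E \<noteq> {}}"

definition children :: "'t set \<Rightarrow> ('t \<Rightarrow> 'b) \<Rightarrow> 'b \<Rightarrow> 't set" where
  "children Ts par B = {T \<in> Ts. par T = B}"

definition shaded_union :: "'t set \<Rightarrow> ('t \<Rightarrow> pt set) \<Rightarrow> pt set" where
  "shaded_union F Y = (\<Union>T\<in>F. Y T)"

definition multiplicity_fn :: "'t set \<Rightarrow> ('t \<Rightarrow> pt set) \<Rightarrow> pt \<Rightarrow> real" where
  "multiplicity_fn F Y x = (\<Sum>T\<in>F. indicator (Y T) x)"

definition total_mass ::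
    "'b set \<Rightarrow> 't set \<Rightarrow> ('t \<Rightarrow> 'b) \<Rightarrow> ('t \<Rightarrow> pt set) \<Rightarrow> ennreal" where
  "total_mass Bs Ts par Y = (\<Sum>B\<in>Bs. \<Sum>T\<in>children Ts par B. emeasure lebesgue (Y T))"

definition N_max :: "'b set \<Rightarrow> 't set \<Rightarrow> ('t \<Rightarrow> 'b) \<Rightarrow> nat" where
  "N_max Bs Ts par = Max ((\<lambda>B. card (children Ts par B)) ` Bs)"

definition level_set :: "'t set \<Rightarrow> ('t \<Rightarrow> pt set) \<Rightarrow> nat \<Rightarrow> pt set" where
  "level_set F Y k = {x. 2 ^ k \<le> multiplicity_fn F Y x \<and> multiplicity_fn F Y x < 2 ^ (k + 1)}"

definition cell_weight ::
    "'t set \<Rightarrow> ('t \<Rightarrow> 'b) \<Rightarrow> ('t \<Rightarrow> pt set) \<Rightarrow> 'b \<times> pt set \<Rightarrow> ennreal" where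
  "cell_weight Ts par Y e =
     (\<Sum>T\<in>children Ts par (fst e). emeasure lebesgue (Y T \<inter> snd e))"

definition positive_pairs ::
    "real \<Rightarrow> 'b set \<Rightarrow> 't set \<Rightarrow> ('t \<Rightarrow> 'b) \<Rightarrow> ('t \<Rightarrow> pt set) \<Rightarrow> ('b \<times> pt set) set" where
  "positive_pairs h Bs Ts par Y =
     {(B, Q). B \<in> Bs \<and> Q \<in> cells h \<and> cell_weight Ts par Y (B, Q) > 0}"

definition cell_degree :: "('b \<times> pt set) set \<Rightarrow> pt set \<Rightarrow> nat" where
  "cell_degree E Q = card {B. (B, Q) \<in> E}"

definition degree_band :: "('b \<times> pt set) set \<Rightarrow> real \<Rightarrow> ('b \<times> pt set) set" where
  "degree_band E d =
     {(B, Q) \<in> E. d \<le> real (cell_degree E Q) \<and> real (cell_degree E Q) < 2 * d}"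

definition cell_region :: "('b \<times> pt set) set \<Rightarrow> 'b \<Rightarrow> pt set" where
  "cell_region E B = \<Union>{Q. (B, Q) \<in> E}"

definition restrict_shading ::
    "('t \<Rightarrow> 'b) \<Rightarrow> ('t \<Rightarrow> pt set) \<Rightarrow> ('b \<times> pt set) set \<Rightarrow> 't \<Rightarrow> pt set" where
  "restrict_shading par Y E T = Y T \<inter> cell_region E (par T)"

text \<open>
  The construction involves choices, so it is a relation between the input
  \<open>h, Bs, Ts, par, Y\<close> and the possible outputs \<open>mu_in, d0, E2, Z, Y1\<close>. The conjuncts follow its
  four steps in order. Dyadic numbers are the integer powers of 2.
\<close>

definition joint_construction ::
    "real \<Rightarrow> 'b set \<Rightarrow> 't set \<Rightarrow> ('t \<Rightarrow> 'b) \<Rightarrow> ('t \<Rightarrow> pt set) \<Rightarrow>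
     real \<Rightarrow> real \<Rightarrow> ('b \<times> pt set) set \<Rightarrow> ('b \<Rightarrow> pt set) \<Rightarrow> ('t \<Rightarrow> pt set) \<Rightarrow> bool" where
  "joint_construction h Bs Ts par Y mu_in d0 E2 Z Y1 \<longleftrightarrow>
    (\<exists>(k0::nat) Y0 Ep E1 (\<omega>0::real) (j::int).
       int k0 \<le> \<lceil>log 2 (real (N_max Bs Ts par))\<rceil> \<and>
       (\<Sum>B\<in>Bs. \<integral>\<^sup>+x\<in>level_set (children Ts par B) Y k0.
            ennreal (multiplicity_fn (children Ts par B) Y x) \<partial>lebesgue)
         \<ge> ennreal (1 / (1 + of_int \<lceil>log 2 (real (N_max Bs Ts par))\<rceil>)) * total_mass Bs Ts par Y \<and>
       mu_in = 2 ^ k0 \<and>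
       Y0 = (\<lambda>T. Y T \<inter> level_set (children Ts par (par T)) Y k0) \<and>

       Ep = positive_pairs h Bs Ts par Y0 \<and>
       E1 \<subseteq> Ep \<and> 0 < \<omega>0 \<and>
       (\<forall>e\<in>E1. ennreal \<omega>0 \<le> cell_weight Ts par Y0 e \<and>
                 cell_weight Ts par Y0 e < ennreal (2 * \<omega>0)) \<and>
       (\<Sum>e\<in>E1. cell_weight Ts par Y0 e)
         \<ge> ennreal (1 / (2 * (1 + of_int \<lceil>log 2 (2 * real (card Ep))\<rceil>))) *
            (\<Sum>e\<in>Ep. cell_weight Ts par Y0 e) \<and>

       d0 = 2 powi j \<and>
       (\<forall>i::int. (\<Sum>e\<in>degree_band E1 (2 powi i). cell_weight Ts par Y0 e)
                  \<le> (\<Sum>e\<in>degree_band E1 d0. cell_weight Ts par Y0 e)) \<and>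
       E2 = degree_band E1 d0 \<and>

       Z = cell_region E2 \<and>
       Y1 = restrict_shading par Y0 E2)"

end

theory Submission
  imports Defs
begin

text \<open>
  All cells have the same positive finite volume, and the pairs surviving the construction have
  weights in \<open>[\<omega>0, 2 * \<omega>0)\<close>. Hence, up to the factor 2, the three quantities
  number of retained pairs, total volume of the retained regions, and retained mass are
  proportional: a proportion \<open>c\<close> of the volume is a proportion \<open>c\<close> of the pairs
  (\<open>sum_emeasure_cell_region\<close>), hence at least a proportion \<open>c / 2\<close> of the mass
  (\<open>total_mass_restrict_shading\<close>). Counting pairs needs the family of pairs to be finite, and this
  follows from the lower weight bound, since the total mass is finite
  (\<open>finite_pairs_if_weight_ge\<close>).

  The three pointwise assertions come from the fact that a point lies in exactly one cell, so that
  restricting a shading to whole cells either keeps all of a parent's multiplicity at a point or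
  removes all of it. Thus on the retained region the inner multiplicity stays in its dyadic band.
  A retained cell is still met by the shading because its weight is positive, and
  no other cell is met. Finally, at a point of a cell \<open>Q\<close> only the fewer than
  \<open>2 * d0\<close> parents paired with \<open>Q\<close> contribute, each of them less than \<open>2 * mu_in\<close>.
\<close>

section \<open>The cell partition\<close>

lemma cells_eq_if_common_point:
  assumes h: "0 < h" and Q: "Q \<in> cells h" "Q' \<in> cells h" and x: "x \<in> Q" "x \<in> Q'"
  shows "Q = Q'"
proof -
  obtain k k' where k: "Q = cell h k" "Q' = cell h k'"
    using Q by (auto simp: cells_def)
  have fl: "l $ i = \<lfloor>x $ i / h\<rfloor>" if "x \<in> cell h l" for l i
    using that h by (auto simp: cell_def field_simps intro!: floor_unique[symmetric])
  have "k = k'"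
    using fl[of k] fl[of k'] x k by (simp add: vec_eq_iff)
  then show ?thesis using k by simp
qed

lemma ex_cell_containing:
  assumes "0 < h"
  shows "\<exists>Q\<in>cells h. x \<in> Q"
proof -
  have "h * of_int \<lfloor>x $ i / h\<rfloor> \<le> x $ i \<and> x $ i < h * (of_int \<lfloor>x $ i / h\<rfloor> + 1)" for i
    using assms of_int_floor_le[of "x $ i / h"] real_of_int_floor_add_one_gt[of "x $ i / h"]
    by (metis mult.commute pos_le_divide_eq pos_divide_less_eq)
  then have "x \<in> cell h (\<chi> i. \<lfloor>x $ i / h\<rfloor>)"
    by (simp add: cell_def)
  then show ?thesis by (auto simp: cells_def)
qed

lemma cells_measurable:
  assumes "Q \<in> cells h"
  shows "Q \<in> sets lebesgue"
proof -
  obtain k where k: "Q = cell h k" using assms by (auto simp: cells_def)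
  have "cell h k = (\<Inter>i. {x. h * of_int (k $ i) \<le> x $ i} \<inter> {x. x $ i < h * (of_int (k $ i) + 1)})"
    by (auto simp: cell_def)
  also have "\<dots> \<in> sets borel"
    by (intro sets.countable_INT'' sets.Int)
       (auto intro!: borel_closed borel_open closed_Collect_le open_Collect_less continuous_intros)
  finally show ?thesis using k by (simp add: sets_completionI_sets)
qed

lemma emeasure_cell:
  assumes h: "0 < h" and Q: "Q \<in> cells h"
  shows "emeasure lebesgue Q = ennreal (h ^ 3)"
proof -
  obtain k where k: "Q = cell h k" using Q by (auto simp: cells_def)
  define l :: pt where "l = (\<chi> i. h * of_int (k $ i))"
  define u :: pt where "u = (\<chi> i. h * (of_int (k $ i) + 1))"
  have lu: "l $ i \<le> u $ i" for i using h by (simp add: l_def u_def)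
  have sub: "box l u \<subseteq> Q" "Q \<subseteq> cbox l u"
    by (auto simp: k cell_def l_def u_def mem_box_cart less_imp_le)
  have "cbox l u \<noteq> {}" using lu by (simp add: interval_ne_empty_cart)
  then have "measure lborel (cbox l u) = (\<Prod>i\<in>UNIV. u $ i - l $ i)"
    by (rule content_cbox_cart)
  also have "\<dots> = h ^ 3" by (simp add: l_def u_def algebra_simps power3_eq_cube)
  finally have "emeasure lborel (cbox l u) = ennreal (h ^ 3)"
    by (metis emeasure_eq_ennreal_measure emeasure_lborel_cbox_finite less_irrefl infinity_ennreal_def)
  moreover have "emeasure lborel (box l u) = emeasure lborel (cbox l u)"
    by (simp add: emeasure_lborel_box_eq emeasure_lborel_cbox_eq)
  moreover have "emeasure lebesgue (box l u) \<le> emeasure lebesgue Q"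
    by (rule emeasure_mono[OF sub(1) cells_measurable[OF Q]])
  moreover have "emeasure lebesgue Q \<le> emeasure lebesgue (cbox l u)"
    by (rule emeasure_mono[OF sub(2)]) simp
  moreover have "emeasure lebesgue (box l u) = emeasure lborel (box l u)"
    "emeasure lebesgue (cbox l u) = emeasure lborel (cbox l u)"
    by simp_all
  ultimately show ?thesis by (metis order_antisym)
qed

lemma mem_cell_region_iff:
  assumes "0 < h" "E \<subseteq> Bs \<times> cells h" "Q \<in> cells h" "x \<in> Q"
  shows "x \<in> cell_region E B \<longleftrightarrow> (B, Q) \<in> E"
proof
  assume "x \<in> cell_region E B"
  then obtain Q' where Q': "(B, Q') \<in> E" "x \<in> Q'" by (auto simp: cell_region_def)
  then have "Q' = Q"
    using assms by (intro cells_eq_if_common_point[of h Q' Q x]) auto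
  then show "(B, Q) \<in> E" using Q' by simp
qed (use assms in \<open>auto simp: cell_region_def\<close>)

section \<open>Mass and volume of a family of cells\<close>

lemma sum_pairs_by_parent:
  assumes "finite E" "finite Bs" "E \<subseteq> Bs \<times> UNIV"
  shows "(\<Sum>B\<in>Bs. \<Sum>Q\<in>{Q. (B, Q) \<in> E}. f (B, Q)) = (\<Sum>e\<in>E. f e)"
proof -
  have "finite {Q. (B, Q) \<in> E}" for B
    using finite_imageI[OF assms(1), of snd] by (rule rev_finite_subset) force
  moreover have "E = Sigma Bs (\<lambda>B. {Q. (B, Q) \<in> E})"
    using assms(3) by auto
  ultimately show ?thesis
    using assms(2) by (subst (2) \<open>E = _\<close>) (simp add: sum.Sigma case_prod_unfold)
qed

lemma emeasure_Int_cell_region: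
  assumes h: "0 < h" and fin: "finite E" and E: "E \<subseteq> Bs \<times> cells h" and S: "S \<in> sets lebesgue"
  shows "emeasure lebesgue (S \<inter> cell_region E B) = (\<Sum>Q\<in>{Q. (B, Q) \<in> E}. emeasure lebesgue (S \<inter> Q))"
proof -
  have "finite {Q. (B, Q) \<in> E}"
    using finite_imageI[OF fin, of snd] by (rule rev_finite_subset) force
  moreover have "disjoint_family_on (\<lambda>Q. S \<inter> Q) {Q. (B, Q) \<in> E}"
    using cells_eq_if_common_point[OF h] E unfolding disjoint_family_on_def by blast
  moreover have "(\<lambda>Q. S \<inter> Q) ` {Q. (B, Q) \<in> E} \<subseteq> sets lebesgue"
    using cells_measurable E S by (auto intro!: sets.Int)
  ultimately have "(\<Sum>Q\<in>{Q. (B, Q) \<in> E}. emeasure lebesgue (S \<inter> Q))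
      = emeasure lebesgue (\<Union>Q\<in>{Q. (B, Q) \<in> E}. S \<inter> Q)"
    by (intro sum_emeasure)
  moreover have "S \<inter> cell_region E B = (\<Union>Q\<in>{Q. (B, Q) \<in> E}. S \<inter> Q)"
    by (auto simp: cell_region_def)
  ultimately show ?thesis by simp
qed

lemma total_mass_restrict_shading:
  assumes h: "0 < h" and fin: "finite E" "finite Bs" and E: "E \<subseteq> Bs \<times> cells h"
    and Y: "\<And>T. T \<in> Ts \<Longrightarrow> Y T \<in> sets lebesgue"
  shows "total_mass Bs Ts par (restrict_shading par Y E) = (\<Sum>e\<in>E. cell_weight Ts par Y e)"
proof -
  have "(\<Sum>T\<in>children Ts par B. emeasure lebesgue (restrict_shading par Y E T))
      = (\<Sum>Q\<in>{Q. (B, Q) \<in> E}. cell_weight Ts par Y (B, Q))" for B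
  proof -
    have "(\<Sum>T\<in>children Ts par B. emeasure lebesgue (restrict_shading par Y E T))
        = (\<Sum>T\<in>children Ts par B. \<Sum>Q\<in>{Q. (B, Q) \<in> E}. emeasure lebesgue (Y T \<inter> Q))"
      using emeasure_Int_cell_region[OF h fin(1) E] Y
      by (intro sum.cong) (auto simp: restrict_shading_def children_def)
    also have "\<dots> = (\<Sum>Q\<in>{Q. (B, Q) \<in> E}. cell_weight Ts par Y (B, Q))"
      by (subst sum.swap) (simp add: cell_weight_def)
    finally show ?thesis .
  qed
  then have "total_mass Bs Ts par (restrict_shading par Y E)
      = (\<Sum>B\<in>Bs. \<Sum>Q\<in>{Q. (B, Q) \<in> E}. cell_weight Ts par Y (B, Q))"
    by (simp add: total_mass_def)
  also have "\<dots> = (\<Sum>e\<in>E. cell_weight Ts par Y e)"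
    using fin E by (intro sum_pairs_by_parent) auto
  finally show ?thesis .
qed

lemma sum_emeasure_cell_region:
  assumes h: "0 < h" and fin: "finite E" "finite Bs" and E: "E \<subseteq> Bs \<times> cells h"
  shows "(\<Sum>B\<in>Bs. emeasure lebesgue (cell_region E B)) = ennreal (real (card E) * h ^ 3)"
proof -
  have "(\<Sum>B\<in>Bs. emeasure lebesgue (cell_region E B))
      = (\<Sum>B\<in>Bs. \<Sum>Q\<in>{Q. (B, Q) \<in> E}. emeasure lebesgue (snd (B, Q)))"
    using emeasure_Int_cell_region[OF h fin(1) E, of UNIV] by simp
  also have "\<dots> = (\<Sum>e\<in>E. emeasure lebesgue (snd e))"
    using fin E by (intro sum_pairs_by_parent) auto
  also have "\<dots> = (\<Sum>e\<in>E. ennreal (h ^ 3))"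
    using emeasure_cell[OF h] E by (intro sum.cong) auto
  also have "\<dots> = ennreal (real (card E) * h ^ 3)"
    using h by (simp add: ennreal_mult'' ennreal_of_nat_eq_real_of_nat)
  finally show ?thesis .
qed

lemma total_mass_mono:
  assumes "\<And>T. T \<in> Ts \<Longrightarrow> Y T \<subseteq> Y' T" "\<And>T. T \<in> Ts \<Longrightarrow> Y' T \<in> sets lebesgue"
  shows "total_mass Bs Ts par Y \<le> total_mass Bs Ts par Y'"
  unfolding total_mass_def using assms
  by (intro sum_mono emeasure_mono) (auto simp: children_def)

text \<open>Disjoint cells of mass at least \<open>w\<close> for some parent cannot be too many when the total mass is finite.\<close>

lemma finite_pairs_if_weight_ge:
  assumes h: "0 < h" and fin: "finite Bs" and E: "E \<subseteq> Bs \<times> cells h"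
    and Y: "\<And>T. T \<in> Ts \<Longrightarrow> Y T \<in> sets lebesgue"
    and M: "total_mass Bs Ts par Y < \<infinity>" and w: "0 < w"
    and weight: "\<And>e. e \<in> E \<Longrightarrow> ennreal w \<le> cell_weight Ts par Y e"
  shows "finite E"
proof -
  obtain m where m: "0 \<le> m" "total_mass Bs Ts par Y = ennreal m"
    using M by (cases "total_mass Bs Ts par Y") auto
  have "card F \<le> nat \<lfloor>m / w\<rfloor>" if F: "F \<subseteq> E" "finite F" for F
  proof -
    have FE: "F \<subseteq> Bs \<times> cells h" using F(1) E by auto
    have "ennreal (real (card F) * w) = (\<Sum>e\<in>F. ennreal w)"
      using w by (simp add: ennreal_mult'' ennreal_of_nat_eq_real_of_nat)
    also have "\<dots> \<le> (\<Sum>e\<in>F. cell_weight Ts par Y e)"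
      using weight F(1) by (intro sum_mono) auto
    also have "\<dots> = total_mass Bs Ts par (restrict_shading par Y F)"
      using total_mass_restrict_shading[where par=par, OF h F(2) fin FE Y] by simp
    also have "\<dots> \<le> ennreal m"
      unfolding m(2)[symmetric] by (intro total_mass_mono Y) (auto simp: restrict_shading_def)
    finally have "real (card F) * w \<le> m" using m(1) by (simp add: ennreal_le_iff)
    then have "real (card F) \<le> m / w" using w by (simp add: field_simps)
    then show ?thesis by (simp add: le_nat_floor)
  qed
  then show ?thesis
    using finite_if_finite_subsets_card_bdd by blast
qed

text \<open>
  Passing from volume to mass costs only the ratio between the largest and the smallest weight:
  volume counts the pairs exactly, and mass counts them up to the factor 2.
\<close>

lemma total_mass_retained:
  fixes E F :: "('b \<times> pt set) set"
  assumes h: "0 < h" and fin: "finite E" "finite Bs" and E: "E \<subseteq> Bs \<times> cells h" and F: "F \<subseteq> E"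
    and Y: "\<And>T. T \<in> Ts \<Longrightarrow> Y T \<in> sets lebesgue"
    and w: "0 < w" and c: "0 < c"
    and weight: "\<And>e. e \<in> E \<Longrightarrow> ennreal w \<le> cell_weight Ts par Y e"
      "\<And>e. e \<in> E \<Longrightarrow> cell_weight Ts par Y e \<le> ennreal (2 * w)"
    and vol: "ennreal c * (\<Sum>B\<in>Bs. emeasure lebesgue (cell_region E B))
      \<le> (\<Sum>B\<in>Bs. emeasure lebesgue (cell_region F B))"
  shows "ennreal (c / 2) * total_mass Bs Ts par (restrict_shading par Y E)
    \<le> total_mass Bs Ts par (restrict_shading par Y F)"
proof -
  have finF: "finite F" and FE: "F \<subseteq> Bs \<times> cells h"
    using F fin E finite_subset by auto
  have "ennreal (c * (real (card E) * h ^ 3)) \<le> ennreal (real (card F) * h ^ 3)"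
    using vol c h
    by (simp add: sum_emeasure_cell_region[OF h fin E] sum_emeasure_cell_region[OF h finF fin(2) FE]
        ennreal_mult'')
  then have "c * (real (card E) * h ^ 3) \<le> real (card F) * h ^ 3"
    using h by (subst (asm) ennreal_le_iff) auto
  then have card: "c * real (card E) \<le> real (card F)"
    using h by (simp flip: mult.assoc)
  have const: "(\<Sum>e\<in>A. ennreal v) = ennreal (real (card A) * v)"
    if "0 \<le> v" for A :: "('b \<times> pt set) set" and v
    using that by (simp add: ennreal_mult'' ennreal_of_nat_eq_real_of_nat)
  have "ennreal (c / 2) * (\<Sum>e\<in>E. cell_weight Ts par Y e) \<le> ennreal (c / 2) * (\<Sum>e\<in>E. ennreal (2 * w))"
    using weight(2) by (intro mult_left_mono sum_mono) auto
  also have "\<dots> = ennreal (c / 2 * (real (card E) * (2 * w)))"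
    using c w by (subst const) (auto simp flip: ennreal_mult)
  also have "\<dots> \<le> ennreal (real (card F) * w)"
    using mult_right_mono[OF card, of w] w by (intro ennreal_leI) (simp add: algebra_simps)
  also have "\<dots> = (\<Sum>e\<in>F. ennreal w)"
    using w by (intro const[symmetric]) simp
  also have "\<dots> \<le> (\<Sum>e\<in>F. cell_weight Ts par Y e)"
    using weight(1) F by (intro sum_mono) auto
  finally show ?thesis
    by (simp add: total_mass_restrict_shading[where par=par, OF h fin E Y]
        total_mass_restrict_shading[where par=par, OF h finF fin(2) FE Y])
qed

section \<open>Multiplicities of restricted shadings\<close>

lemma level_set_measurable:
  assumes "\<And>T. T \<in> F \<Longrightarrow> Y T \<in> sets lebesgue"
  shows "level_set F Y k \<in> sets lebesgue"
proof -
  have [measurable]: "multiplicity_fn F Y \<in> borel_measurable lebesgue"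
    unfolding multiplicity_fn_def[abs_def]
    using assms by (intro borel_measurable_sum borel_measurable_indicator)
  have "{x \<in> space lebesgue. 2 ^ k \<le> multiplicity_fn F Y x \<and> multiplicity_fn F Y x < 2 ^ (k + 1)}
      \<in> sets lebesgue"
    by measurable
  then show ?thesis by (simp add: level_set_def)
qed

text \<open>
  The set to which the shadings of one parent are restricted does not depend on the child, so at a
  point of that set none of the multiplicity is lost.
\<close>

lemma multiplicity_fn_restricted:
  assumes "x \<in> shaded_union (children Ts par B)
    (restrict_shading par (\<lambda>T. Y T \<inter> level_set (children Ts par (par T)) Y k) E)"
  shows "x \<in> cell_region E B"
    and "2 ^ k \<le> multiplicity_fn (children Ts par B)
      (restrict_shading par (\<lambda>T. Y T \<inter> level_set (children Ts par (par T)) Y k) E) x"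
    and "multiplicity_fn (children Ts par B)
      (restrict_shading par (\<lambda>T. Y T \<inter> level_set (children Ts par (par T)) Y k) E) x < 2 * 2 ^ k"
proof -
  show x: "x \<in> cell_region E B"
    using assms by (auto simp: shaded_union_def restrict_shading_def children_def)
  have L: "x \<in> level_set (children Ts par B) Y k"
    using assms by (auto simp: shaded_union_def restrict_shading_def children_def)
  have "multiplicity_fn (children Ts par B)
      (restrict_shading par (\<lambda>T. Y T \<inter> level_set (children Ts par (par T)) Y k) E) x
    = multiplicity_fn (children Ts par B) Y x"
    unfolding multiplicity_fn_def using x L
    by (intro sum.cong) (auto simp: restrict_shading_def children_def indicator_def)
  then show "2 ^ k \<le> multiplicity_fn (children Ts par B)
      (restrict_shading par (\<lambda>T. Y T \<inter> level_set (children Ts par (par T)) Y k) E) x"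
    "multiplicity_fn (children Ts par B)
      (restrict_shading par (\<lambda>T. Y T \<inter> level_set (children Ts par (par T)) Y k) E) x < 2 * 2 ^ k"
    using L by (auto simp: level_set_def)
qed

lemma multiplicity_fn_eq_0:
  assumes "x \<notin> shaded_union F Y"
  shows "multiplicity_fn F Y x = 0"
  using assms by (auto simp: multiplicity_fn_def shaded_union_def intro!: sum.neutral)

lemma multiplicity_fn_sum_children:
  assumes "finite Bs" "finite Ts" "\<And>T. T \<in> Ts \<Longrightarrow> par T \<in> Bs"
  shows "multiplicity_fn Ts Y x = (\<Sum>B\<in>Bs. multiplicity_fn (children Ts par B) Y x)"
  unfolding multiplicity_fn_def children_def
  using assms by (intro sum.group[symmetric]) auto

text \<open>
  Positive weight means that the shading meets the cell, so passing to the shading and back to the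
  cells it meets recovers exactly the chosen cells.
\<close>

lemma cell_region_eq_cell_hull:
  assumes h: "0 < h" and E: "E \<subseteq> Bs \<times> cells h"
    and pos: "\<And>e. e \<in> E \<Longrightarrow> 0 < cell_weight Ts par Y e"
  shows "cell_region E B = cell_hull h (shaded_union (children Ts par B) (restrict_shading par Y E))"
proof -
  have "Q \<in> cells h \<and> Q \<inter> shaded_union (children Ts par B) (restrict_shading par Y E) \<noteq> {}
      \<longleftrightarrow> (B, Q) \<in> E" for Q
  proof
    assume "Q \<in> cells h \<and> Q \<inter> shaded_union (children Ts par B) (restrict_shading par Y E) \<noteq> {}"
    then obtain x where "Q \<in> cells h" "x \<in> Q" "x \<in> cell_region E B"
      by (auto simp: shaded_union_def restrict_shading_def children_def)
    then show "(B, Q) \<in> E" using mem_cell_region_iff[OF h E] by auto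
  next
    assume Q: "(B, Q) \<in> E"
    have "\<not> (\<forall>T\<in>children Ts par B. Y T \<inter> Q = {})"
    proof
      assume "\<forall>T\<in>children Ts par B. Y T \<inter> Q = {}"
      then have "cell_weight Ts par Y (B, Q) = 0" by (simp add: cell_weight_def)
      then show False using pos[OF Q] by simp
    qed
    then obtain T x where "T \<in> children Ts par B" "x \<in> Y T" "x \<in> Q" by auto
    then show "Q \<in> cells h \<and> Q \<inter> shaded_union (children Ts par B) (restrict_shading par Y E) \<noteq> {}"
      using Q E by (auto simp: shaded_union_def restrict_shading_def children_def cell_region_def)
  qed
  then show ?thesis by (auto simp: cell_region_def cell_hull_def)
qed

text \<open>
  At a point of the cell \<open>Q\<close> only the parents paired with \<open>Q\<close> contribute, which turns a bound
  for each parent into a product bound.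
\<close>

lemma multiplicity_fn_le_degree:
  assumes h: "0 < h" and E: "E \<subseteq> Bs \<times> cells h" and Q: "Q \<in> cells h" "x \<in> Q"
    and fin: "finite Bs" "finite Ts" and par: "\<And>T. T \<in> Ts \<Longrightarrow> par T \<in> Bs"
    and m: "\<And>B. x \<in> shaded_union (children Ts par B) Y
      \<Longrightarrow> x \<in> cell_region E B \<and> multiplicity_fn (children Ts par B) Y x \<le> m"
    and "0 \<le> m"
  shows "multiplicity_fn Ts Y x \<le> real (cell_degree E Q) * m"
proof -
  have sub: "{B. (B, Q) \<in> E} \<subseteq> Bs" using E by auto
  have "multiplicity_fn Ts Y x = (\<Sum>B\<in>Bs. multiplicity_fn (children Ts par B) Y x)"
    using multiplicity_fn_sum_children[OF fin par] .
  also have "\<dots> = (\<Sum>B\<in>{B. (B, Q) \<in> E}. multiplicity_fn (children Ts par B) Y x)"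
    using m mem_cell_region_iff[OF h E Q]
    by (intro sum.mono_neutral_right fin sub) (auto intro!: multiplicity_fn_eq_0)
  also have "\<dots> \<le> real (card {B. (B, Q) \<in> E}) * m"
  proof (rule sum_bounded_above)
    show "multiplicity_fn (children Ts par B) Y x \<le> m" for B
      using m[of B] multiplicity_fn_eq_0[of x "children Ts par B" Y] \<open>0 \<le> m\<close>
      by (cases "x \<in> shaded_union (children Ts par B) Y") auto
  qed
  finally show ?thesis by (simp add: cell_degree_def)
qed

lemma cell_degree_mono:
  assumes "E \<subseteq> E'" "E' \<subseteq> Bs \<times> UNIV" "finite Bs"
  shows "cell_degree E Q \<le> cell_degree E' Q"
proof -
  have "finite {B. (B, Q) \<in> E'}"
    using assms(3) by (rule rev_finite_subset) (use assms(2) in auto)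
  then show ?thesis unfolding cell_degree_def using assms(1) by (intro card_mono) auto
qed

section \<open>Stability of the joint construction\<close>

text \<open>
  The stability argument rests on three features of the output: on each parent the multiplicity lies
  in one dyadic level, the selected pairs have weights within a factor 2, and the cells have
  comparable degrees.
\<close>

lemma joint_construction_outputE:
  assumes "joint_construction h Bs Ts par Y mu_in d0 E2 Z Y1"
  obtains k0 :: nat and Y0 E1 w where
    "mu_in = 2 ^ k0"
    "Y0 = (\<lambda>T. Y T \<inter> level_set (children Ts par (par T)) Y k0)"
    "E1 \<subseteq> positive_pairs h Bs Ts par Y0" "0 < w"
    "\<forall>e\<in>E1. ennreal w \<le> cell_weight Ts par Y0 e \<and>
        cell_weight Ts par Y0 e < ennreal (2 * w)"
    "E2 = degree_band E1 d0" "Z = cell_region E2" "Y1 = restrict_shading par Y0 E2"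
  using assms[unfolded joint_construction_def]
  apply (elim exE conjE)
  subgoal premises p for k0 Y0 Ep E1 w j
    using p(6,7,9) by (intro that[of k0 Y0 E1 w, OF p(4,5) _ p(8) _ p(13,14,15)]) auto
  done

theorem theorem5p1:
  fixes a b r c0 h c mu_in d0 :: real
    and Bs :: "'b set" and box_of :: "'b \<Rightarrow> (real ^ 3) set"
    and Ts :: "'t set" and par :: "'t \<Rightarrow> 'b"
    and carrier_of Y Y1 Ystar :: "'t \<Rightarrow> (real ^ 3) set"
    and E2 Estar :: "('b \<times> (real ^ 3) set) set"
    and Z Zstar :: "'b \<Rightarrow> (real ^ 3) set"
  assumes "0 < a" and "a \<le> b" and "b \<le> r"
    and "0 < c0" and "c0 \<le> 1 / 10 ^ 3" and "h = c0 * a"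
    and "finite Bs" and "Bs \<noteq> {}"
    and "\<And>B. B \<in> Bs \<Longrightarrow> rect_box a b r (box_of B)"
    and "finite Ts" and "\<And>T. T \<in> Ts \<Longrightarrow> par T \<in> Bs"
    and "\<And>T. T \<in> Ts \<Longrightarrow> carrier_of T \<subseteq> box_of (par T)"
    and "\<And>T. T \<in> Ts \<Longrightarrow> Y T \<in> sets lebesgue"
    and "\<And>T. T \<in> Ts \<Longrightarrow> Y T \<subseteq> carrier_of T"
    and "0 < total_mass Bs Ts par Y" and "total_mass Bs Ts par Y < \<infinity>"
    and "joint_construction h Bs Ts par Y mu_in d0 E2 Z Y1"
    and "0 < c" and "c \<le> 1"
    and "Estar \<subseteq> E2"
    and "Zstar = cell_region Estar"
    and "(\<Sum>B\<in>Bs. emeasure lebesgue (Zstar B)) \<ge> ennreal c * (\<Sum>B\<in>Bs. emeasure lebesgue (Z B))"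
    and "Ystar = restrict_shading par Y1 Estar"
  shows "total_mass Bs Ts par Ystar \<ge> ennreal (c / 2) * total_mass Bs Ts par Y1
    \<and> (\<forall>B\<in>Bs. \<forall>x\<in>shaded_union (children Ts par B) Ystar.
          mu_in \<le> multiplicity_fn (children Ts par B) Ystar x \<and>
          multiplicity_fn (children Ts par B) Ystar x < 2 * mu_in)
    \<and> (\<forall>B\<in>Bs. Zstar B = cell_hull h (shaded_union (children Ts par B) Ystar))
    \<and> (\<forall>x\<in>shaded_union Ts Ystar. multiplicity_fn Ts Ystar x < 4 * mu_in * d0)"
proof -
  obtain k0 :: nat and Y0 E1 w where
    mu: "mu_in = 2 ^ k0"
    and Y0: "Y0 = (\<lambda>T. Y T \<inter> level_set (children Ts par (par T)) Y k0)"
    and E1: "E1 \<subseteq> positive_pairs h Bs Ts par Y0" and w: "0 < w"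
    and weight: "\<forall>e\<in>E1. ennreal w \<le> cell_weight Ts par Y0 e \<and>
                   cell_weight Ts par Y0 e < ennreal (2 * w)"
    and E2: "E2 = degree_band E1 d0"
    and Z: "Z = cell_region E2" and Y1: "Y1 = restrict_shading par Y0 E2"
    using assms(17) by (rule joint_construction_outputE)
  have h: "0 < h" using assms by simp
  note finB = \<open>finite Bs\<close> and finT = \<open>finite Ts\<close> and vol = assms(22)
  have Y0_meas: "Y0 T \<in> sets lebesgue" if "T \<in> Ts" for T
    unfolding Y0 using that assms(13)
    by (intro sets.Int level_set_measurable) (auto simp: children_def)
  have "total_mass Bs Ts par Y0 \<le> total_mass Bs Ts par Y"
    using assms(13) by (intro total_mass_mono) (auto simp: Y0)
  then have M0: "total_mass Bs Ts par Y0 < \<infinity>"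
    using assms(16) by (rule le_less_trans)
  have E1_sub: "E1 \<subseteq> Bs \<times> cells h"
    using E1 by (auto simp: positive_pairs_def)
  have finE1: "finite E1"
    using finite_pairs_if_weight_ge[where par=par, OF h finB E1_sub Y0_meas M0 w] weight by auto
  have E21: "E2 \<subseteq> E1" by (auto simp: E2 degree_band_def)
  have E2_sub: "E2 \<subseteq> Bs \<times> cells h" and finE2: "finite E2"
    using E21 E1_sub finE1 finite_subset by auto
  have Es1: "Estar \<subseteq> E1" and Es_sub: "Estar \<subseteq> Bs \<times> cells h"
    using \<open>Estar \<subseteq> E2\<close> E21 E1_sub by auto
  have Ystar: "Ystar = restrict_shading par Y0 Estar"
    using \<open>Estar \<subseteq> E2\<close> unfolding \<open>Ystar = restrict_shading par Y1 Estar\<close> Y1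
    by (auto simp: restrict_shading_def cell_region_def fun_eq_iff)

  have mass: "ennreal (c / 2) * total_mass Bs Ts par Y1 \<le> total_mass Bs Ts par Ystar"
    unfolding Y1 Ystar
  proof (rule total_mass_retained[OF h finE2 finB E2_sub \<open>Estar \<subseteq> E2\<close> Y0_meas w \<open>0 < c\<close>])
    show "ennreal w \<le> cell_weight Ts par Y0 e" "cell_weight Ts par Y0 e \<le> ennreal (2 * w)"
      if "e \<in> E2" for e
      using weight E21 that by (auto simp: less_imp_le)
    show "ennreal c * (\<Sum>B\<in>Bs. emeasure lebesgue (cell_region E2 B))
        \<le> (\<Sum>B\<in>Bs. emeasure lebesgue (cell_region Estar B))"
      using vol by (simp only: Z \<open>Zstar = cell_region Estar\<close>)
  qed

  have inner: "x \<in> cell_region Estar B"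
      "mu_in \<le> multiplicity_fn (children Ts par B) Ystar x"
      "multiplicity_fn (children Ts par B) Ystar x < 2 * mu_in"
    if "x \<in> shaded_union (children Ts par B) Ystar" for B x
    using multiplicity_fn_restricted[of x Ts par B Y k0 Estar] that
    unfolding Ystar Y0 mu by auto

  have hull: "Zstar B = cell_hull h (shaded_union (children Ts par B) Ystar)" for B
    unfolding \<open>Zstar = cell_region Estar\<close> Ystar
    using Es1 E1 by (intro cell_region_eq_cell_hull[OF h Es_sub]) (auto simp: positive_pairs_def)

  have outer: "multiplicity_fn Ts Ystar x < 4 * mu_in * d0" if x: "x \<in> shaded_union Ts Ystar" for x
  proof -
    obtain Q where Q: "Q \<in> cells h" "x \<in> Q" using ex_cell_containing[OF h] by blast
    obtain B where "x \<in> shaded_union (children Ts par B) Ystar"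
      using x by (auto simp: shaded_union_def children_def)
    \<comment> \<open>The degree in \<open>E1\<close> is controlled only for cells of the band, and \<open>Q\<close> is one of them.\<close>
    then have "(B, Q) \<in> E2"
      using inner(1) mem_cell_region_iff[OF h Es_sub Q] \<open>Estar \<subseteq> E2\<close> by auto
    then have deg: "real (cell_degree E1 Q) < 2 * d0"
      by (auto simp: E2 degree_band_def)
    have mu0: "0 < mu_in" by (simp add: mu)
    have "multiplicity_fn Ts Ystar x \<le> real (cell_degree Estar Q) * (2 * mu_in)"
      using inner(1,3) assms(11) mu0
      by (intro multiplicity_fn_le_degree[OF h Es_sub Q finB finT]) (auto simp: less_imp_le)
    also have "\<dots> \<le> real (cell_degree E1 Q) * (2 * mu_in)"
      using cell_degree_mono[OF Es1 _ finB] E1_sub mu0 by (intro mult_right_mono) auto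
    also have "\<dots> < 2 * d0 * (2 * mu_in)"
      using deg mu0 by (intro mult_strict_right_mono) auto
    finally show ?thesis by (simp add: algebra_simps)
  qed
  show ?thesis using mass inner hull outer by auto
qed

end
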